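(* Let $0<\alpha<2$, let $\psi$ be a Bernstein function regularly varying at zero of index $\alpha/2$ with $\psi(0)=0$ and $\psi(1)=1$, and let $(\tau_n)$ be the associated discrete subordinator. Set $F_n(t)=\mathbb{P}(\tau_n\le t)$. If $n$ and $t$ both tend to infinity in such a way that $n\psi(t^{-1})$ tends to zero, then $$1-F_n(t)\sim\frac{n\,\psi(t^{-1})}{\Gamma(1-\alpha/2)}.$$
   Context: A Bernstein function is a function $\psi:[0,\infty)\to[0,\infty)$, continuous on $[0,\infty)$ and smooth on $(0,\infty)$, with $(-1)^n\psi^{(n)}(x)\le0$ for all integers $n\ge1$ and $x>0$. It has a representation $\psi(x)=a+bx+\int_{[0,\infty)}(1-e^{-xs})\,d\nu(s)$ with $a,b\ge0$ and a measure $\nu$ with $\int\min\{1,s\}\,d\nu(s)<\infty$. It is regularly varying at zero of index $\beta$ if $\psi(x)=x^{\beta}\ell(1/x)$ near $0$, where $\ell(\lambda x)/\ell(x)\to1$ as $x\to\infty$ for every $\lambda>0$. For $\psi$ with $\psi(0)=0,\psi(1)=1$ and integers $k\ge1$ put $c(\psi,k)=\frac1{k!}\int_{[0,\infty)}t^ke^{-t}\,d\nu(t)+b\,\mathbf 1_{\{k=1\}}$; these are nonnegative and sum to $1$. The discrete subordinator is $\tau_n=R_1+\dots+R_n$ with $R_i$ i.i.d., $\mathbb{P}(R_i=k)=c(\psi,k)$. $f\sim g$ in the stated regime means that $f/g\to1$ along every sequence in that regime. *)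

theory Defs
  imports "HOL-Probability.Probability"
begin

text \<open>Functions on \<open>[0,\<infinity>)\<close> are total functions on the reals; their values on the negative half-line
  are never used.\<close>

definition bernstein_function :: "(real \<Rightarrow> real) \<Rightarrow> bool" where
  "bernstein_function \<psi> \<longleftrightarrow>
     (\<forall>x\<ge>0. 0 \<le> \<psi> x) \<and>
     continuous_on {0..} \<psi> \<and>
     (\<forall>n. \<forall>x>0. (deriv ^^ n) \<psi> differentiable (at x)) \<and>
     (\<forall>n\<ge>1. \<forall>x>0. (-1) ^ n * (deriv ^^ n) \<psi> x \<le> 0)"

text \<open>The measure \<open>\<nu>\<close> is carried by the Borel sets of the whole line, but only its restriction to
  \<open>[0,\<infinity>)\<close> enters. A point mass at \<open>0\<close>, even an infinite one, does not contribute to any of the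
  integrals below. Every Bernstein function has such a triplet (Bernstein's theorem).\<close>

definition levy_triplet :: "(real \<Rightarrow> real) \<Rightarrow> real \<Rightarrow> real \<Rightarrow> real measure \<Rightarrow> bool" where
  "levy_triplet \<psi> a b \<nu> \<longleftrightarrow>
     0 \<le> a \<and> 0 \<le> b \<and> sets \<nu> = sets borel \<and>
     set_integrable \<nu> {0..} (\<lambda>s. min 1 s) \<and>
     (\<forall>x\<ge>0. \<psi> x = a + b * x + (LINT s:{0..}|\<nu>. 1 - exp (- x * s)))"

definition slowly_varying :: "(real \<Rightarrow> real) \<Rightarrow> bool" where
  "slowly_varying l \<longleftrightarrow> (\<forall>c>0. ((\<lambda>x. l (c * x) / l x) \<longlongrightarrow> 1) at_top)"

definition regularly_varying_at_zero :: "real \<Rightarrow> (real \<Rightarrow> real) \<Rightarrow> bool" where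
  "regularly_varying_at_zero \<beta> \<psi> \<longleftrightarrow>
     (\<exists>l. slowly_varying l \<and> (\<forall>\<^sub>F x in at_right 0. \<psi> x = x powr \<beta> * l (1 / x)))"

text \<open>The number \<open>c(\<psi>,k)\<close>, for \<open>k \<ge> 1\<close>, in terms of the triplet of \<open>\<psi>\<close>.\<close>

definition step_prob :: "real \<Rightarrow> real measure \<Rightarrow> nat \<Rightarrow> real" where
  "step_prob b \<nu> k =
     1 / fact k * (LINT t:{0..}|\<nu>. t ^ k * exp (- t)) + (if k = 1 then b else 0)"

text \<open>Since the step probabilities over \<open>k \<ge> 1\<close> sum to \<open>1\<close> when \<open>\<psi> 0 = 0\<close> and \<open>\<psi> 1 = 1\<close>, the
  value \<open>0\<close> has probability zero and the law of each step is determined.\<close>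

definition subordinator_steps ::
    "'w measure \<Rightarrow> real \<Rightarrow> real measure \<Rightarrow> (nat \<Rightarrow> 'w \<Rightarrow> nat) \<Rightarrow> bool" where
  "subordinator_steps M b \<nu> R \<longleftrightarrow>
     prob_space M \<and>
     prob_space.indep_vars M (\<lambda>_. count_space UNIV) R {1..} \<and>
     (\<forall>i\<ge>1. \<forall>k\<ge>1. measure M {\<omega> \<in> space M. R i \<omega> = k} = step_prob b \<nu> k)"

definition discrete_subordinator :: "(nat \<Rightarrow> 'w \<Rightarrow> nat) \<Rightarrow> nat \<Rightarrow> 'w \<Rightarrow> nat" where
  "discrete_subordinator R n \<omega> = (\<Sum>i=1..n. R i \<omega>)"

definition subordinator_cdf :: "'w measure \<Rightarrow> (nat \<Rightarrow> 'w \<Rightarrow> nat) \<Rightarrow> nat \<Rightarrow> real \<Rightarrow> real" where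
  "subordinator_cdf M R n t = measure M {\<omega> \<in> space M. real (discrete_subordinator R n \<omega>) \<le> t}"

end

theory Submission
  imports Defs
begin

text \<open>A single step has generating function \<open>E z^R = 1 - \<psi> (1 - z)\<close>, so that
  \<open>1 - E exp (- m \<tau>\<^sub>n / t) = 1 - (1 - \<psi> (1 - exp (- m / t)))^n\<close>. When \<open>n \<psi> (1 / t) \<longlonglongrightarrow> 0\<close> this is
  equivalent to \<open>n \<psi> (m / t)\<close>, hence by regular variation to \<open>m powr (\<alpha> / 2) * n \<psi> (1 / t)\<close>.
  The passage from these Laplace transforms to the tail is a Tauberian argument in the style of
  Karamata: with \<open>Y = \<tau>\<^sub>n / t\<close>, the functionals
  \<open>f \<mapsto> E (\<integral>\<^sub>0\<^sup>Y f (exp (- u)) exp (- u) du) / (n \<psi> (1 / t))\<close> converge on monomials to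
  \<open>\<integral>\<^sub>0\<^sup>\<infinity> f (exp (- u)) exp (- u) u powr (- \<alpha> / 2) du / \<Gamma>(1 - \<alpha> / 2)\<close>, hence, by Weierstrass
  approximation, on continuous \<open>f\<close>. Bumps on intervals just to the right and just to the left of
  \<open>u = 1\<close> then bound \<open>P (Y > 1)\<close> from below and from above.\<close>

section \<open>Generating functions\<close>

text \<open>For \<open>s \<ge> 0\<close> the integrand is at most both \<open>1\<close> and
  \<open>x * s\<close>, hence at most \<open>(1 + x) * min 1 s\<close>, which the condition on
  \<open>\<nu>\<close> makes integrable.\<close>

lemma levy_triplet_integrable:
  assumes "levy_triplet \<psi> a b \<nu>" "x \<ge> 0"
  shows "set_integrable \<nu> {0..} (\<lambda>s. 1 - exp (- x * s))"
proof -
  have [measurable_cong]: "sets \<nu> = sets borel"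
    using assms by (simp add: levy_triplet_def)
  have "set_integrable \<nu> {0..} (\<lambda>s. min 1 s)"
    using assms by (simp add: levy_triplet_def)
  hence "set_integrable \<nu> {0..} (\<lambda>s. (1 + x) * min 1 s)" by simp
  thus ?thesis
  proof (rule set_integrable_bound, goal_cases)
    case 1 thus ?case unfolding set_borel_measurable_def by measurable
  next
    case 2
    show ?case
    proof (rule AE_I2, rule impI)
      fix s assume "s \<in> {0::real..}"
      hence s: "0 \<le> s" by simp
      have "1 + - (x * s) \<le> exp (- (x * s))" by (rule exp_ge_add_one_self)
      moreover have "exp (- (x * s)) \<le> 1" "exp (- (x * s)) \<ge> 0"
        using s assms by auto
      moreover have "x * s \<ge> 0" using s assms by simp
      ultimately show "norm (1 - exp (- x * s)) \<le> norm ((1 + x) * min 1 s)"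
        using s assms by (auto simp: min_def algebra_simps)
    qed
  qed
qed

lemma levy_triplet_mono:
  assumes "levy_triplet \<psi> a b \<nu>" "0 \<le> x" "x \<le> y"
  shows "\<psi> x \<le> \<psi> y"
proof -
  have "(LINT s:{0..}|\<nu>. 1 - exp (- x * s)) \<le> (LINT s:{0..}|\<nu>. 1 - exp (- y * s))"
    using assms by (intro set_integral_mono levy_triplet_integrable[OF assms(1)])
      (auto intro: mult_right_mono)
  moreover have "b * x \<le> b * y"
    using assms by (auto simp: levy_triplet_def intro: mult_left_mono)
  ultimately show ?thesis
    using assms by (simp add: levy_triplet_def)
qed

text \<open>This is concavity seen from the origin: \<open>1 - exp (- y)\<close> is concave and
  vanishes at 0, the drift scales exactly, and the constant \<open>a \<ge> 0\<close> only helps.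
  Together with monotonicity it later compares \<open>\<psi>\<close> at
  \<open>1 - exp (- (m * x))\<close> and at \<open>m * x\<close>.\<close>

lemma levy_triplet_scale:
  assumes "levy_triplet \<psi> a b \<nu>" "0 \<le> x" "0 \<le> c" "c \<le> 1"
  shows "c * \<psi> x \<le> \<psi> (c * x)"
proof -
  have conc: "c * (1 - exp (- y)) \<le> 1 - exp (- (c * y))" for y :: real
    using convex_onD[OF exp_convex, of c 0 "- y"] assms(3,4) by (simp add: algebra_simps)
  have "c * (LINT s:{0..}|\<nu>. 1 - exp (- x * s)) = (LINT s:{0..}|\<nu>. c * (1 - exp (- x * s)))"
    by simp
  also have "\<dots> \<le> (LINT s:{0..}|\<nu>. 1 - exp (- (c * x) * s))"
    using assms conc[of "x * _"]
    by (intro set_integral_mono set_integrable_mult_right levy_triplet_integrable[OF assms(1)])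
      (auto simp: mult.assoc)
  finally have "c * (LINT s:{0..}|\<nu>. 1 - exp (- x * s)) \<le> (LINT s:{0..}|\<nu>. 1 - exp (- (c * x) * s))" .
  moreover have "c * a \<le> a"
    using assms by (auto simp: levy_triplet_def intro: mult_left_le_one_le)
  ultimately show ?thesis
    using assms by (simp add: levy_triplet_def algebra_simps)
qed

section \<open>Generating functions of a single step and of the subordinator\<close>

text \<open>Expanding \<open>exp (t * z) - 1\<close> in powers of \<open>t * z\<close> and
  integrating term by term against \<open>exp (- t)\<close> and \<open>\<nu>\<close> produces the
  step probabilities. The series starts at exponent 1, hence the \<open>Suc k\<close>, and the
  constant \<open>a\<close> cancels in the difference.\<close>

lemma step_prob_gf:
  assumes L: "levy_triplet \<psi> a b \<nu>" and z: "0 \<le> z" "z \<le> 1"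
  shows "(\<lambda>k. step_prob b \<nu> (Suc k) * z ^ Suc k) sums (\<psi> 1 - \<psi> (1 - z))"
proof -
  have [measurable_cong]: "sets \<nu> = sets borel"
    using L by (simp add: levy_triplet_def)
  define s where "s N t = (\<Sum>k<N. (t * z) ^ Suc k / fact (Suc k)) * exp (- t)" for N and t :: real
  have exp_sums: "(\<lambda>k. y ^ Suc k / fact (Suc k)) sums (exp y - 1)" for y :: real
    using exp_converges[of y] by (subst sums_Suc_iff) (simp add: divide_inverse mult.commute)
  \<comment> \<open>A single term of the exponential series is at most \<open>exp t - 1\<close>, so
    after multiplication by \<open>exp (- t)\<close> a multiple of \<open>1 - exp (- t)\<close>
    dominates.\<close>
  have int1: "set_integrable \<nu> {0..} (\<lambda>t. t ^ Suc k * exp (- t))" for k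
  proof -
    have "set_integrable \<nu> {0..} (\<lambda>t. fact (Suc k) * (1 - exp (- 1 * t)))"
      using levy_triplet_integrable[OF L, of 1] by simp
    thus ?thesis
    proof (rule set_integrable_bound, goal_cases)
      case 1 thus ?case unfolding set_borel_measurable_def by measurable
    next
      case 2
      show ?case
      proof (rule AE_I2, rule impI)
        fix t assume "t \<in> {0::real..}"
        hence t: "0 \<le> t" by simp
        have "t ^ Suc k / fact (Suc k) \<le> exp t - 1"
          using sum_le_suminf[OF sums_summable[OF exp_sums[of t]], of "{k}"] sums_unique[OF exp_sums[of t]] t
          by auto
        hence "t ^ Suc k \<le> fact (Suc k) * (exp t - 1)"
          by (subst (asm) pos_divide_le_eq) (auto simp: mult.commute)
        hence "t ^ Suc k * exp (- t) \<le> fact (Suc k) * (exp t - 1) * exp (- t)"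
          by (intro mult_right_mono) auto
        also have "\<dots> = fact (Suc k) * (1 - exp (- 1 * t))"
          by (simp add: algebra_simps flip: exp_add)
        finally show "norm (t ^ Suc k * exp (- t)) \<le> norm (fact (Suc k) * (1 - exp (- 1 * t)) :: real)"
          using t by (simp add: abs_mult)
      qed
    qed
  qed
  \<comment> \<open>The drift is set to 0 because the integral sees only \<open>\<nu>\<close>. It
    affects the first coefficient alone and is restored below as \<open>b * z\<close>.\<close>
  have s_int: "(LINT t:{0..}|\<nu>. s N t) = (\<Sum>k<N. step_prob 0 \<nu> (Suc k) * z ^ Suc k)" for N
  proof -
    have "(LINT t:{0..}|\<nu>. s N t) =
        (LINT t:{0..}|\<nu>. (\<Sum>k<N. z ^ Suc k / fact (Suc k) * (t ^ Suc k * exp (- t))))"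
      unfolding s_def sum_distrib_right power_mult_distrib
      by (intro set_lebesgue_integral_cong) (auto simp: field_simps intro!: sum.cong)
    also have "\<dots> = (\<Sum>k<N. LINT t:{0..}|\<nu>. z ^ Suc k / fact (Suc k) * (t ^ Suc k * exp (- t)))"
      unfolding set_lebesgue_integral_def scaleR_sum_right
      using set_integrable_mult_right[OF int1] unfolding set_integrable_def
      by (intro Bochner_Integration.integral_sum) blast
    also have "\<dots> = (\<Sum>k<N. step_prob 0 \<nu> (Suc k) * z ^ Suc k)"
      by (intro sum.cong refl, subst set_integral_mult_right) (simp add: step_prob_def)
    finally show ?thesis .
  qed
  have lim: "(\<lambda>N. LINT t:{0..}|\<nu>. s N t) \<longlonglongrightarrow> (LINT t:{0..}|\<nu>. (exp (t * z) - 1) * exp (- t))"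
    unfolding set_lebesgue_integral_def
  proof (rule integral_dominated_convergence)
    show "integrable \<nu> (\<lambda>t. indicat_real {0..} t *\<^sub>R (1 - exp (- 1 * t)))"
      using levy_triplet_integrable[OF L, of 1] by (simp add: set_integrable_def)
    show "(\<lambda>t. indicat_real {0..} t *\<^sub>R ((exp (t * z) - 1) * exp (- t))) \<in> borel_measurable \<nu>"
      by measurable
    show "(\<lambda>t. indicat_real {0..} t *\<^sub>R s N t) \<in> borel_measurable \<nu>" for N
      unfolding s_def by measurable
    show "AE t in \<nu>. (\<lambda>N. indicat_real {0..} t *\<^sub>R s N t)
       \<longlonglongrightarrow> indicat_real {0..} t *\<^sub>R ((exp (t * z) - 1) * exp (- t))"
      using exp_sums unfolding s_def sums_def by (intro AE_I2 tendsto_intros)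
    \<comment> \<open>Since \<open>z \<le> 1\<close>, all partial sums lie below
      \<open>exp t - 1\<close>, so one majorant serves every \<open>N\<close>.\<close>
    show "AE t in \<nu>. norm (indicat_real {0..} t *\<^sub>R s N t) \<le> indicat_real {0..} t *\<^sub>R (1 - exp (- 1 * t))" for N
    proof (rule AE_I2)
      fix t :: real
      show "norm (indicat_real {0..} t *\<^sub>R s N t) \<le> indicat_real {0..} t *\<^sub>R (1 - exp (- 1 * t))"
      proof (cases "t \<ge> 0")
        case t: True
        have nn: "0 \<le> (\<Sum>k<N. (t * z) ^ Suc k / fact (Suc k))"
          using t z by (intro sum_nonneg) auto
        have "(\<Sum>k<N. (t * z) ^ Suc k / fact (Suc k)) \<le> exp (t * z) - 1"
          using sum_le_suminf[OF sums_summable[OF exp_sums[of "t * z"]], of "{..<N}"]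
            sums_unique[OF exp_sums[of "t * z"]] t z by auto
        also have "\<dots> \<le> exp t - 1" using t z by (simp add: mult_left_le)
        finally have "s N t \<le> (exp t - 1) * exp (- t)"
          unfolding s_def by (intro mult_right_mono) auto
        moreover have "0 \<le> s N t" unfolding s_def using nn by simp
        ultimately show ?thesis using t by (simp add: algebra_simps flip: exp_add)
      qed simp
    qed
  qed
  have "(\<lambda>k. step_prob 0 \<nu> (Suc k) * z ^ Suc k) sums
      (LINT t:{0..}|\<nu>. (exp (t * z) - 1) * exp (- t))"
    using lim unfolding s_int sums_def .
  moreover have "(\<lambda>k. (if k = 0 then b * z else 0)) sums (b * z)"
    using sums_single[of 0 "\<lambda>_. b * z"] by simp
  ultimately have "(\<lambda>k. step_prob 0 \<nu> (Suc k) * z ^ Suc k + (if k = 0 then b * z else 0)) sums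
      ((LINT t:{0..}|\<nu>. (exp (t * z) - 1) * exp (- t)) + b * z)"
    by (rule sums_add)
  also have "(\<lambda>k. step_prob 0 \<nu> (Suc k) * z ^ Suc k + (if k = 0 then b * z else 0)) =
      (\<lambda>k. step_prob b \<nu> (Suc k) * z ^ Suc k)"
    by (auto simp: step_prob_def algebra_simps)
  \<comment> \<open>The product is a difference of two exponentials, neither of which need be
    integrable when \<open>\<nu>\<close> has infinite mass near 0. Subtracting each from 1 gives
    integrable parts.\<close>
  also have "(LINT t:{0..}|\<nu>. (exp (t * z) - 1) * exp (- t)) =
      (LINT t:{0..}|\<nu>. (1 - exp (- 1 * t)) - (1 - exp (- (1 - z) * t)))"
    by (intro set_lebesgue_integral_cong) (auto simp: algebra_simps simp flip: exp_add)
  also have "\<dots> = (LINT t:{0..}|\<nu>. 1 - exp (- 1 * t)) - (LINT t:{0..}|\<nu>. 1 - exp (- (1 - z) * t))"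
    using z by (intro set_integral_diff levy_triplet_integrable[OF L]) auto
  also have "\<dots> + b * z = \<psi> 1 - \<psi> (1 - z)"
    using L z by (simp add: levy_triplet_def algebra_simps)
  finally show ?thesis .
qed

text \<open>The partial sums are \<open>z ^ X\<close> cut off to \<open>X < N\<close>; they are
  bounded by 1, so dominated convergence applies, also at \<open>z = 1\<close>.\<close>

lemma (in prob_space) expectation_power_sums:
  fixes X :: "'a \<Rightarrow> nat"
  assumes X[measurable]: "X \<in> measurable M (count_space UNIV)" and z: "0 \<le> z" "z \<le> (1::real)"
  shows "(\<lambda>k. prob {\<omega> \<in> space M. X \<omega> = k} * z ^ k) sums expectation (\<lambda>\<omega>. z ^ X \<omega>)"
proof -
  have s: "(\<Sum>k<N. indicator {\<omega> \<in> space M. X \<omega> = k} \<omega> * z ^ k) = (if X \<omega> < N then z ^ X \<omega> else 0)"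
    if "\<omega> \<in> space M" for \<omega> N
  proof -
    have "(\<Sum>k<N. indicator {\<omega> \<in> space M. X \<omega> = k} \<omega> * z ^ k) = (\<Sum>k\<in>{..<N}. if X \<omega> = k then z ^ k else 0)"
      using that by (intro sum.cong) (auto simp: indicator_def)
    also have "\<dots> = (if X \<omega> < N then z ^ X \<omega> else 0)" by (subst sum.delta') auto
    finally show ?thesis .
  qed
  have "(\<lambda>N. expectation (\<lambda>\<omega>. \<Sum>k<N. indicator {\<omega> \<in> space M. X \<omega> = k} \<omega> * z ^ k))
      \<longlonglongrightarrow> expectation (\<lambda>\<omega>. z ^ X \<omega>)"
  proof (rule integral_dominated_convergence)
    show "integrable M (\<lambda>_. 1 :: real)" by simp
    show "AE \<omega> in M. (\<lambda>N. \<Sum>k<N. indicator {\<omega> \<in> space M. X \<omega> = k} \<omega> * z ^ k) \<longlonglongrightarrow> z ^ X \<omega>"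
    proof (rule AE_I2)
      fix \<omega> assume w: "\<omega> \<in> space M"
      have "\<forall>\<^sub>F N in sequentially. (\<Sum>k<N. indicator {\<omega> \<in> space M. X \<omega> = k} \<omega> * z ^ k) = z ^ X \<omega>"
        using eventually_gt_at_top[of "X \<omega>"] by eventually_elim (subst s[OF w], simp)
      thus "(\<lambda>N. \<Sum>k<N. indicator {\<omega> \<in> space M. X \<omega> = k} \<omega> * z ^ k) \<longlonglongrightarrow> z ^ X \<omega>"
        by (rule tendsto_eventually)
    qed
    show "AE \<omega> in M. norm (\<Sum>k<N. indicator {\<omega> \<in> space M. X \<omega> = k} \<omega> * z ^ k) \<le> 1" for N
      using z by (intro AE_I2, subst s) (simp_all add: power_le_one)
  qed measurable
  also have "(\<lambda>N. expectation (\<lambda>\<omega>. \<Sum>k<N. indicator {\<omega> \<in> space M. X \<omega> = k} \<omega> * z ^ k)) =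
      (\<lambda>N. \<Sum>k<N. prob {\<omega> \<in> space M. X \<omega> = k} * z ^ k)"
  proof (intro ext)
    fix N
    have A[measurable]: "{\<omega> \<in> space M. X \<omega> = k} \<in> events" for k by measurable
    have I: "integrable M (\<lambda>\<omega>. indicator {\<omega> \<in> space M. X \<omega> = k} \<omega> * z ^ k)" for k
      by (intro integrable_mult_left integrable_real_indicator A) (simp add: emeasure_eq_measure)
    have "expectation (indicat_real {\<omega> \<in> space M. X \<omega> = k}) = prob {\<omega> \<in> space M. X \<omega> = k}" for k
      using Int_absorb2[OF sets.sets_into_space[OF A[of k]]] Bochner_Integration.integral_indicator[of M] by simp
    thus "expectation (\<lambda>\<omega>. \<Sum>k<N. indicator {\<omega> \<in> space M. X \<omega> = k} \<omega> * z ^ k) =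
        (\<Sum>k<N. prob {\<omega> \<in> space M. X \<omega> = k} * z ^ k)"
      by (simp only: Bochner_Integration.integral_sum[OF I] integral_mult_left_zero)
  qed
  finally show ?thesis by (simp add: sums_def)
qed

text \<open>The assumptions prescribe the probabilities of the values \<open>k \<ge> 1\<close> only,
  so the mass at 0 first appears as an unknown summand. Evaluation at \<open>z = 1\<close>, where
  \<open>\<psi> 0 = 0\<close> enters, shows that it vanishes.\<close>

lemma step_gf:
  assumes S: "subordinator_steps M b \<nu> R" and L: "levy_triplet \<psi> a b \<nu>"
    and psi: "\<psi> 0 = 0" "\<psi> 1 = 1" and i: "i \<ge> 1" and z: "0 \<le> z" "z \<le> (1::real)"
  shows "(LINT \<omega>|M. z ^ R i \<omega>) = 1 - \<psi> (1 - z)"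
proof -
  interpret prob_space M using S by (simp add: subordinator_steps_def)
  have R: "R i \<in> measurable M (count_space UNIV)"
    using S i by (simp add: subordinator_steps_def indep_vars_def)
  have P: "prob {\<omega> \<in> space M. R i \<omega> = Suc k} = step_prob b \<nu> (Suc k)" for k
    using S i by (simp add: subordinator_steps_def)
  have gf: "expectation (\<lambda>\<omega>. z ^ R i \<omega>) = 1 - \<psi> (1 - z) + prob {\<omega> \<in> space M. R i \<omega> = 0}"
    if "0 \<le> z" "z \<le> (1::real)" for z
  proof -
    have "(\<lambda>k. prob {\<omega> \<in> space M. R i \<omega> = Suc k} * z ^ Suc k) sums
        (expectation (\<lambda>\<omega>. z ^ R i \<omega>) - prob {\<omega> \<in> space M. R i \<omega> = 0} * z ^ 0)"
      using expectation_power_sums[OF R that] by (subst sums_Suc_iff) simp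
    from sums_unique2[OF this[unfolded P] step_prob_gf[OF L that]] show ?thesis
      using psi by simp
  qed
  have "prob {\<omega> \<in> space M. R i \<omega> = 0} = 0"
    using gf[of 1] psi by (simp add: prob_space)
  thus ?thesis using gf[OF z] by simp
qed

lemma discrete_subordinator_measurable:
  assumes "subordinator_steps M b \<nu> R"
  shows "discrete_subordinator R n \<in> measurable M (count_space UNIV)"
proof -
  have [measurable]: "R i \<in> measurable M (count_space UNIV)" if "i \<in> {1..n}" for i
    using assms that by (auto simp: subordinator_steps_def prob_space.indep_vars_def)
  show ?thesis unfolding discrete_subordinator_def[abs_def] by measurable
qed

lemma discrete_subordinator_gf:
  assumes S: "subordinator_steps M b \<nu> R" and L: "levy_triplet \<psi> a b \<nu>"
    and psi: "\<psi> 0 = 0" "\<psi> 1 = 1" and z: "0 \<le> z" "z \<le> (1::real)"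
  shows "(LINT \<omega>|M. z ^ discrete_subordinator R n \<omega>) = (1 - \<psi> (1 - z)) ^ n"
proof -
  interpret prob_space M using S by (simp add: subordinator_steps_def)
  have ind: "indep_vars (\<lambda>_. count_space UNIV) R {1..n}"
    using S by (auto simp: subordinator_steps_def intro: indep_vars_subset)
  have ind': "indep_vars (\<lambda>_. borel) (\<lambda>i \<omega>. z ^ R i \<omega>) {1..n}"
    by (rule indep_vars_compose2[OF ind]) simp
  have rv: "R i \<in> measurable M (count_space UNIV)" if "i \<in> {1..n}" for i
    using ind that by (simp add: indep_vars_def)
  have "expectation (\<lambda>\<omega>. z ^ discrete_subordinator R n \<omega>) =
      expectation (\<lambda>\<omega>. \<Prod>i\<in>{1..n}. z ^ R i \<omega>)"
    by (simp add: discrete_subordinator_def power_sum)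
  also have "\<dots> = (\<Prod>i\<in>{1..n}. expectation (\<lambda>\<omega>. z ^ R i \<omega>))"
  proof (rule indep_vars_lebesgue_integral[OF _ ind'])
    fix i assume "i \<in> {1..n}"
    note rv[OF this, measurable]
    show "integrable M (\<lambda>\<omega>. z ^ R i \<omega>)"
      using z by (intro integrable_const_bound[where B = 1]) (auto simp: power_le_one)
  qed simp
  also have "\<dots> = (1 - \<psi> (1 - z)) ^ n"
    using step_gf[OF S L psi _ z] by simp
  finally show ?thesis .
qed

section \<open>A Tauberian theorem for families of tails\<close>

text \<open>Linearity carries convergence from monomials to polynomials, and a three-epsilon
  argument carries it to continuous functions. The case \<open>m = 0\<close> keeps the norms
  \<open>L j (\<lambda>_. 1)\<close> bounded for large \<open>j\<close>. The bounds look at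
  \<open>{0..1}\<close> only, since the functionals will evaluate \<open>f\<close> at points
  \<open>exp (- u)\<close> with \<open>u \<ge> 0\<close>.\<close>

lemma weierstrass_tendsto:
  fixes L :: "nat \<Rightarrow> (real \<Rightarrow> real) \<Rightarrow> real" and \<Lambda> :: "(real \<Rightarrow> real) \<Rightarrow> real"
  assumes linL: "\<And>j c f g. continuous_on UNIV f \<Longrightarrow> continuous_on UNIV g \<Longrightarrow>
        L j (\<lambda>z. c * f z + g z) = c * L j f + L j g"
    and lin: "\<And>c f g. continuous_on UNIV f \<Longrightarrow> continuous_on UNIV g \<Longrightarrow>
        \<Lambda> (\<lambda>z. c * f z + g z) = c * \<Lambda> f + \<Lambda> g"
    and bdL: "\<And>j f e. continuous_on UNIV f \<Longrightarrow> (\<And>z. z \<in> {0..1} \<Longrightarrow> \<bar>f z\<bar> \<le> e) \<Longrightarrow>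
        \<bar>L j f\<bar> \<le> e * L j (\<lambda>_. 1)"
    and bd: "\<And>f e. continuous_on UNIV f \<Longrightarrow> (\<And>z. z \<in> {0..1} \<Longrightarrow> \<bar>f z\<bar> \<le> e) \<Longrightarrow>
        \<bar>\<Lambda> f\<bar> \<le> e * \<Lambda> (\<lambda>_. 1)"
    and mon: "\<And>m. (\<lambda>j. L j (\<lambda>z. z ^ m)) \<longlonglongrightarrow> \<Lambda> (\<lambda>z. z ^ m)"
    and f: "continuous_on UNIV f"
  shows "(\<lambda>j. L j f) \<longlonglongrightarrow> \<Lambda> f"
proof -
  \<comment> \<open>The bound with \<open>e = 0\<close> forces the value 0 on the zero function,
    which starts the induction on the degree.\<close>
  have zero: "L j (\<lambda>_. 0) = 0" "\<Lambda> (\<lambda>_. 0) = 0" for j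
    using bdL[of "\<lambda>_. 0" 0 j] bd[of "\<lambda>_. 0" 0] by auto
  have poly: "(\<lambda>j. L j (\<lambda>z. \<Sum>i<N. a i * z ^ i)) \<longlonglongrightarrow> \<Lambda> (\<lambda>z. \<Sum>i<N. a i * z ^ i)"
    for a :: "nat \<Rightarrow> real" and N :: nat
  proof (induction N)
    case 0 show ?case by (simp add: zero)
  next
    case (Suc N)
    have c: "continuous_on UNIV (\<lambda>z::real. z ^ N)" "continuous_on UNIV (\<lambda>z. \<Sum>i<N. a i * z ^ i)"
      by (intro continuous_intros)+
    have eq: "(\<lambda>z. \<Sum>i<Suc N. a i * z ^ i) = (\<lambda>z. a N * z ^ N + (\<Sum>i<N. a i * z ^ i))"
      by (simp add: add.commute)
    show ?case unfolding eq linL[OF c] lin[OF c] by (intro tendsto_intros mon Suc.IH)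
  qed
  define K where "K = \<bar>\<Lambda> (\<lambda>_. 1)\<bar> + 1"
  have K: "K > 0" by (simp add: K_def)
  have "(\<lambda>j. L j (\<lambda>_. 1)) \<longlonglongrightarrow> \<Lambda> (\<lambda>_. 1)" using mon[of 0] by simp
  hence evK: "\<forall>\<^sub>F j in sequentially. L j (\<lambda>_. 1) < K"
    by (rule order_tendstoD) (simp add: K_def abs_if)
  show ?thesis
  proof (rule tendstoI)
    fix e :: real assume e: "e > 0"
    \<comment> \<open>With this accuracy of the polynomial, each of the two approximation errors is
      at most \<open>e / 3\<close>.\<close>
    define d where "d = e / (3 * K)"
    have d: "d > 0" "d * K = e / 3" using e K by (auto simp: d_def)
    obtain p where p: "real_polynomial_function p" "\<And>z. z \<in> {0..1} \<Longrightarrow> \<bar>f z - p z\<bar> < d"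
      using Stone_Weierstrass_real_polynomial_function[of "{0..1}" f d]
        continuous_on_subset[OF f] d by auto
    obtain a N where "p = (\<lambda>z. \<Sum>i\<le>N. a i * z ^ i)"
      using p(1) by (auto simp: real_polynomial_function_iff_sum)
    hence pa: "p = (\<lambda>z. \<Sum>i<Suc N. a i * z ^ i)" by (simp only: lessThan_Suc_atMost)
    have cp: "continuous_on UNIV p" unfolding pa by (intro continuous_intros)
    have cd: "continuous_on UNIV (\<lambda>z. (-1) * p z + f z)" by (intro continuous_intros cp f)
    have dd: "\<bar>(-1) * p z + f z\<bar> \<le> d" if "z \<in> {0..1}" for z using p(2)[OF that] by auto
    have A: "\<bar>L j f - L j p\<bar> \<le> d * L j (\<lambda>_. 1)" for j
      using bdL[OF cd dd, of j] linL[OF cp f, of j "-1"] by simp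
    have B: "\<bar>\<Lambda> f - \<Lambda> p\<bar> \<le> d * \<Lambda> (\<lambda>_. 1)"
      using bd[OF cd dd] lin[OF cp f, of "-1"] by simp
    have "d * \<Lambda> (\<lambda>_. 1) \<le> d * K" using d by (intro mult_left_mono) (auto simp: K_def)
    with B d have B': "\<bar>\<Lambda> f - \<Lambda> p\<bar> \<le> e / 3" by linarith
    have "\<forall>\<^sub>F j in sequentially. dist (L j p) (\<Lambda> p) < e / 3"
      using poly[where N = "Suc N" and a = a] e unfolding pa by (intro tendstoD) auto
    with evK show "\<forall>\<^sub>F j in sequentially. dist (L j f) (\<Lambda> f) < e"
    proof eventually_elim
      case (elim j)
      have "d * L j (\<lambda>_. 1) \<le> d * K" using d elim by (intro mult_left_mono) auto
      with A[of j] d have "\<bar>L j f - L j p\<bar> \<le> e / 3" by linarith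
      thus ?case using elim B' unfolding dist_real_def by linarith
    qed
  qed
qed

section \<open>The prelimit functional and the limit functional\<close>

text \<open>Euler's integral for the Gamma function after the substitution of \<open>c * u\<close>
  for \<open>u\<close>.\<close>

lemma Gamma_integral_scaled:
  fixes s c :: real
  assumes "s > 0" "c > 0"
  shows "has_bochner_integral lborel (\<lambda>u. indicator {0..} u * (exp (- (c * u)) * u powr (s - 1))) (Gamma s / c powr s)"
proof -
  define g :: "real \<Rightarrow> real" where "g u = indicator {0..} u * (u powr (s - 1) / exp u)" for u
  have "has_bochner_integral lborel g (Gamma s)"
  proof (rule has_bochner_integral_nn_integral)
    show "(\<integral>\<^sup>+ x. ennreal (g x) \<partial>lborel) = ennreal (Gamma s)"
      using Gamma_conv_nn_integral_real[OF assms(1)] by (simp add: g_def)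
    show "g \<in> borel_measurable lborel" unfolding g_def by measurable
  qed (use assms in \<open>auto simp: g_def Gamma_real_pos less_imp_le\<close>)
  hence "has_bochner_integral lborel (\<lambda>u. g (0 + c * u)) (Gamma s /\<^sub>R \<bar>c\<bar>)"
    using assms by (subst (asm) lborel_has_bochner_integral_real_affine_iff[of c _ _ 0]) auto
  \<comment> \<open>The extra factor cancels the \<open>c powr (s - 1)\<close> that comes out of
    \<open>(c * u) powr (s - 1)\<close>.\<close>
  hence "has_bochner_integral lborel (\<lambda>u. g (0 + c * u) * c powr (1 - s)) (Gamma s /\<^sub>R \<bar>c\<bar> * c powr (1 - s))"
    by (rule has_bochner_integral_mult_left)
  also have "(\<lambda>u. g (0 + c * u) * c powr (1 - s)) =
      (\<lambda>u. indicator {0..} u * (exp (- (c * u)) * u powr (s - 1)))"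
  proof
    fix u :: real
    have "c powr (s - 1) * c powr (1 - s) = 1" using assms by (simp flip: powr_add)
    thus "g (0 + c * u) * c powr (1 - s) = indicator {0..} u * (exp (- (c * u)) * u powr (s - 1))"
      using assms by (auto simp: g_def indicator_def powr_mult exp_minus field_simps zero_le_mult_iff)
  qed
  also have "Gamma s /\<^sub>R \<bar>c\<bar> * c powr (1 - s) = Gamma s / c powr s"
    using assms by (simp add: powr_diff field_simps)
  finally show ?thesis .
qed

text \<open>For \<open>y \<ge> 0\<close> the substitution \<open>z = exp (- u)\<close> identifies
  this with the integral of \<open>f\<close> over the interval from \<open>exp (- y)\<close> to 1;
  for \<open>y < 0\<close> the value is 0.\<close>

definition exp_integral :: "(real \<Rightarrow> real) \<Rightarrow> real \<Rightarrow> real" where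
  "exp_integral f y = (LINT u|lborel. indicator {0..y} u * (f (exp (- u)) * exp (- u)))"

lemma exp_integral_integrable:
  assumes "continuous_on UNIV f"
  shows "integrable lborel (\<lambda>u. indicator {0..y} u * (f (exp (- u)) * exp (- u)) :: real)"
proof -
  have "continuous_on {0..y} (\<lambda>u. f (exp (- u)) * exp (- u))"
    by (intro continuous_intros continuous_on_compose2[OF assms]) auto
  from borel_integrable_compact[OF _ this] show ?thesis by simp
qed

lemma exp_integral_measurable:
  assumes "continuous_on UNIV f"
  shows "exp_integral f \<in> borel_measurable borel"
proof -
  have [measurable]: "f \<in> borel_measurable borel"
    by (rule borel_measurable_continuous_onI[OF assms])
  \<comment> \<open>With the indicator of a \<open>y\<close>-dependent interval replaced by
    inequalities, the integrand is visibly jointly measurable in \<open>y\<close> and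
    \<open>u\<close>.\<close>
  have eq: "exp_integral f =
      (\<lambda>y. LINT u|lborel. (if 0 \<le> u \<and> u \<le> y then f (exp (- u)) * exp (- u) else 0))"
    unfolding exp_integral_def by (intro ext Bochner_Integration.integral_cong) (auto simp: indicator_def)
  show ?thesis unfolding eq by measurable
qed

lemma exp_integral_linear:
  assumes "continuous_on UNIV f" "continuous_on UNIV g"
  shows "exp_integral (\<lambda>z. c * f z + g z) y = c * exp_integral f y + exp_integral g y"
proof -
  have "exp_integral (\<lambda>z. c * f z + g z) y =
     (LINT u|lborel. c * (indicator {0..y} u * (f (exp (- u)) * exp (- u)))
         + indicator {0..y} u * (g (exp (- u)) * exp (- u)))"
    unfolding exp_integral_def by (intro Bochner_Integration.integral_cong) (auto simp: algebra_simps)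
  thus ?thesis unfolding exp_integral_def
    using exp_integral_integrable[OF assms(1)] exp_integral_integrable[OF assms(2)] by simp
qed

lemma exp_integral_mono:
  assumes "continuous_on UNIV f" "continuous_on UNIV g" "\<And>z. z \<in> {0..1} \<Longrightarrow> f z \<le> g z"
  shows "exp_integral f y \<le> exp_integral g y"
  unfolding exp_integral_def
  using assms by (intro integral_mono exp_integral_integrable) (auto simp: indicator_def)

lemma exp_integral_abs_le:
  assumes "continuous_on UNIV f" "\<And>z. z \<in> {0..1} \<Longrightarrow> \<bar>f z\<bar> \<le> e"
  shows "\<bar>exp_integral f y\<bar> \<le> e * exp_integral (\<lambda>_. 1) y"
proof -
  have b: "f z \<le> e" "- e \<le> f z" if "z \<in> {0..1}" for z
    using assms(2)[OF that] by linarith+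
  have z: "exp_integral (\<lambda>_. 0) y = 0" by (simp add: exp_integral_def)
  have sc: "exp_integral (\<lambda>_. c) y = c * exp_integral (\<lambda>_. 1) y" for c
    using exp_integral_linear[of "\<lambda>_. 1" "\<lambda>_. 0" c y] z by simp
  have "exp_integral f y \<le> exp_integral (\<lambda>_. e) y"
    using assms(1) b by (intro exp_integral_mono) auto
  moreover have "exp_integral (\<lambda>_. - e) y \<le> exp_integral f y"
    using assms(1) b by (intro exp_integral_mono) auto
  ultimately show ?thesis
    using sc[of e] sc[of "- e"] by linarith
qed

text \<open>This is the link to Laplace transforms: the weight \<open>exp (- u)\<close> raises the
  exponent from \<open>m\<close> to \<open>Suc m\<close>, so only transforms at positive integers
  occur.\<close>

lemma exp_integral_power:
  assumes "y \<ge> 0"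
  shows "exp_integral (\<lambda>z. z ^ m) y = (1 - exp (- (real (Suc m) * y))) / real (Suc m)"
proof -
  have e: "exp (- u) ^ m * exp (- u) = exp (- (real (Suc m) * u))" for u :: real
    by (simp add: algebra_simps flip: exp_of_nat_mult exp_add)
  have "exp_integral (\<lambda>z. z ^ m) y =
      (LINT u|lborel. exp (- (real (Suc m) * u)) * indicator {0..y} u)"
    unfolding exp_integral_def e by (simp add: mult.commute)
  also have "\<dots> = - exp (- (real (Suc m) * y)) / real (Suc m) - (- exp (- (real (Suc m) * 0)) / real (Suc m))"
    using assms
    by (intro integral_FTC_Icc_real[where F = "\<lambda>u. - exp (- (real (Suc m) * u)) / real (Suc m)"])
      (auto intro!: derivative_eq_intros continuous_intros simp del: of_nat_Suc)
  finally show ?thesis by (simp add: diff_divide_distrib)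
qed

text \<open>By Fubini the expectation of \<open>exp_integral f Y\<close> is the integral of
  \<open>f (exp (- u)) * exp (- u)\<close> against the tail of \<open>Y\<close>. The weight
  \<open>u powr (- \<beta>) / Gamma (1 - \<beta>)\<close> is thus the expected limit of the
  normalised tail at \<open>u\<close>.\<close>

definition gamma_functional :: "real \<Rightarrow> (real \<Rightarrow> real) \<Rightarrow> real" where
  "gamma_functional \<beta> f =
     (LINT u|lborel. indicator {0..} u * (f (exp (- u)) * exp (- u) * u powr (- \<beta>))) / Gamma (1 - \<beta>)"

text \<open>On \<open>{0..1}\<close> the function \<open>f\<close> is bounded, so a multiple of the
  integrand of Euler's integral at \<open>1 - \<beta> > 0\<close> dominates.\<close>

lemma gamma_functional_integrable:
  fixes f :: "real \<Rightarrow> real"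
  assumes f: "continuous_on UNIV f" and \<beta>: "\<beta> < 1"
  shows "integrable lborel (\<lambda>u. indicator {0..} u * (f (exp (- u)) * exp (- u) * u powr (- \<beta>)))"
proof -
  have [measurable]: "f \<in> borel_measurable borel"
    by (rule borel_measurable_continuous_onI[OF f])
  have "bounded (f ` {0..1})"
    by (intro compact_imp_bounded compact_continuous_image continuous_on_subset[OF f]) auto
  then obtain B where B: "\<And>z. z \<in> {0..1} \<Longrightarrow> \<bar>f z\<bar> \<le> B"
    unfolding bounded_iff by (metis imageI real_norm_def)
  have "integrable lborel (\<lambda>u. B * (indicator {0..} u * (exp (- (1 * u)) * u powr ((1 - \<beta>) - 1))))"
    using Gamma_integral_scaled[of "1 - \<beta>" 1] \<beta>
    by (intro integrable_mult_right) (auto simp: has_bochner_integral_iff)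
  thus ?thesis
  proof (rule Bochner_Integration.integrable_bound)
    show "AE u in lborel. norm (indicator {0..} u * (f (exp (- u)) * exp (- u) * u powr (- \<beta>)))
        \<le> norm (B * (indicator {0..} u * (exp (- (1 * u)) * u powr ((1 - \<beta>) - 1))))"
    proof (rule AE_I2)
      fix u :: real
      show "norm (indicator {0..} u * (f (exp (- u)) * exp (- u) * u powr (- \<beta>)))
        \<le> norm (B * (indicator {0..} u * (exp (- (1 * u)) * u powr ((1 - \<beta>) - 1))))"
        using B[of "exp (- u)"] by (auto simp: indicator_def abs_mult intro!: mult_right_mono)
    qed
  qed measurable
qed

lemma gamma_functional_linear:
  assumes "continuous_on UNIV f" "continuous_on UNIV g" "\<beta> < 1"
  shows "gamma_functional \<beta> (\<lambda>z. c * f z + g z) = c * gamma_functional \<beta> f + gamma_functional \<beta> g"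
proof -
  have "gamma_functional \<beta> (\<lambda>z. c * f z + g z) =
     (LINT u|lborel. c * (indicator {0..} u * (f (exp (- u)) * exp (- u) * u powr (- \<beta>)))
         + indicator {0..} u * (g (exp (- u)) * exp (- u) * u powr (- \<beta>))) / Gamma (1 - \<beta>)"
    unfolding gamma_functional_def
    by (intro arg_cong2[where f = "(/)"] Bochner_Integration.integral_cong) (auto simp: algebra_simps)
  thus ?thesis unfolding gamma_functional_def
    using gamma_functional_integrable[OF assms(1,3)] gamma_functional_integrable[OF assms(2,3)]
    by (simp add: add_divide_distrib)
qed

lemma gamma_functional_mono:
  assumes "continuous_on UNIV f" "continuous_on UNIV g" "\<beta> < 1" "\<And>z. z \<in> {0..1} \<Longrightarrow> f z \<le> g z"
  shows "gamma_functional \<beta> f \<le> gamma_functional \<beta> g"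
  unfolding gamma_functional_def
  using assms
  by (intro divide_right_mono integral_mono gamma_functional_integrable)
    (auto simp: indicator_def Gamma_real_pos less_imp_le intro!: mult_right_mono)

lemma gamma_functional_abs_le:
  assumes "continuous_on UNIV f" "\<beta> < 1" "\<And>z. z \<in> {0..1} \<Longrightarrow> \<bar>f z\<bar> \<le> e"
  shows "\<bar>gamma_functional \<beta> f\<bar> \<le> e * gamma_functional \<beta> (\<lambda>_. 1)"
proof -
  have b: "f z \<le> e" "- e \<le> f z" if "z \<in> {0..1}" for z
    using assms(3)[OF that] by linarith+
  have z: "gamma_functional \<beta> (\<lambda>_. 0) = 0" by (simp add: gamma_functional_def)
  have sc: "gamma_functional \<beta> (\<lambda>_. c) = c * gamma_functional \<beta> (\<lambda>_. 1)" for c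
    using gamma_functional_linear[of "\<lambda>_. 1" "\<lambda>_. 0" \<beta> c] z assms by simp
  have "gamma_functional \<beta> f \<le> gamma_functional \<beta> (\<lambda>_. e)"
    using assms(1,2) b by (intro gamma_functional_mono) auto
  moreover have "gamma_functional \<beta> (\<lambda>_. - e) \<le> gamma_functional \<beta> f"
    using assms(1,2) b by (intro gamma_functional_mono) auto
  ultimately show ?thesis
    using sc[of e] sc[of "- e"] by linarith
qed

lemma gamma_functional_power:
  assumes "\<beta> < 1"
  shows "gamma_functional \<beta> (\<lambda>z. z ^ m) = real (Suc m) powr \<beta> / real (Suc m)"
proof -
  have e: "exp (- u) ^ m * exp (- u) = exp (- (real (Suc m) * u))" for u :: real
    by (simp add: algebra_simps flip: exp_of_nat_mult exp_add)
  have "gamma_functional \<beta> (\<lambda>z. z ^ m) = Gamma (1 - \<beta>) / real (Suc m) powr (1 - \<beta>) / Gamma (1 - \<beta>)"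
    unfolding gamma_functional_def e
    using has_bochner_integral_integral_eq[OF Gamma_integral_scaled[of "1 - \<beta>" "real (Suc m)"]] assms
    by simp
  also have "\<dots> = real (Suc m) powr \<beta> / real (Suc m)"
    using assms Gamma_real_pos[of "1 - \<beta>"]
    by (simp add: powr_diff less_imp_neq[symmetric] del: of_nat_Suc)
  finally show ?thesis .
qed

section \<open>Bump functions and the convergence of tails\<close>

text \<open>Integrating a parabolic bump supported on \<open>{a..c}\<close> gives a ramp in
  \<open>y\<close> that rises from 0 to \<open>I\<close>, a continuous substitute for a multiple of
  an indicator. The bounds on the limit functional hold because \<open>u powr (- \<beta>)\<close>
  decreases and \<open>u\<close> stays between \<open>a\<close> and \<open>c\<close>.\<close>

lemma bump_exists:
  fixes a c :: real
  assumes ac: "0 < a" "a < c"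
  obtains f :: "real \<Rightarrow> real" and I :: real where
    "continuous_on UNIV f" "I > 0"
    "\<And>y. 0 \<le> exp_integral f y" "\<And>y. exp_integral f y \<le> I"
    "\<And>y. y \<le> a \<Longrightarrow> exp_integral f y = 0" "\<And>y. c \<le> y \<Longrightarrow> exp_integral f y = I"
    "\<And>\<beta>. 0 < \<beta> \<Longrightarrow> \<beta> < 1 \<Longrightarrow> I * (c powr (- \<beta>) / Gamma (1 - \<beta>)) \<le> gamma_functional \<beta> f"
    "\<And>\<beta>. 0 < \<beta> \<Longrightarrow> \<beta> < 1 \<Longrightarrow> gamma_functional \<beta> f \<le> I * (a powr (- \<beta>) / Gamma (1 - \<beta>))"
proof -
  \<comment> \<open>\<open>f\<close> is chosen such that \<open>f (exp (- u)) * exp (- u) = h u\<close>; cutting off at \<open>exp (- c)\<close>, where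
    \<open>h\<close> vanishes, makes it continuous on the whole line.\<close>
  define h where "h u = max 0 ((u - a) * (c - u))" for u
  define f where "f z = h (- ln (max (exp (- c)) z)) / max (exp (- c)) z" for z
  define I where "I = (LINT u|lborel. h u)"
  have h_nn: "0 \<le> h u" for u by (simp add: h_def)
  \<comment> \<open>As a polynomial times an indicator, \<open>h\<close> can be integrated by the
    fundamental theorem of calculus.\<close>
  have h_eq: "h u = (u - a) * (c - u) * indicator {a..c} u" for u
    using ac by (cases "u < a"; cases "u > c")
      (auto simp: h_def indicator_def max_def mult_le_0_iff not_less zero_le_mult_iff)
  have h_out: "h u = 0" if "u \<notin> {a<..<c}" for u
    using that by (auto simp: h_eq indicator_def)
  have pos: "max (exp (- c)) z > 0" for z by (simp add: less_max_iff_disj)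
  have cf: "continuous_on UNIV f"
    unfolding f_def h_def by (intro continuous_intros) (use pos in \<open>auto simp: less_imp_neq[symmetric]\<close>)
  have fe: "f (exp (- u)) * exp (- u) = h u" for u
  proof (cases "u \<le> c")
    case True
    hence "max (exp (- c)) (exp (- u)) = exp (- u)" by (simp add: max_def)
    thus ?thesis by (simp add: f_def)
  next
    case False
    hence "max (exp (- c)) (exp (- u)) = exp (- c)" by (simp add: max_def)
    thus ?thesis using False by (simp add: f_def h_out)
  qed
  have hI: "has_bochner_integral lborel h ((c - a) ^ 3 / 6)"
  proof -
    define F where "F u = - (u ^ 3 / 3) + (a + c) * u ^ 2 / 2 - a * c * u" for u
    have "has_bochner_integral lborel (\<lambda>u. (u - a) * (c - u) * indicator {a..c} u) (F c - F a)"
      using ac unfolding F_def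
      by (intro has_bochner_integral_FTC_Icc_real)
        (auto intro!: derivative_eq_intros continuous_intros simp: field_simps power2_eq_square)
    also have "F c - F a = (c - a) ^ 3 / 6"
      by (simp add: F_def field_simps power3_eq_cube power2_eq_square)
    finally show ?thesis unfolding h_eq[abs_def] .
  qed
  have Ival: "I = (c - a) ^ 3 / 6" and hint: "integrable lborel h"
    using hI by (auto simp: I_def has_bochner_integral_iff)
  have I: "I > 0" using ac by (simp add: Ival)
  have E: "exp_integral f y = (LINT u|lborel. indicator {0..y} u * h u)" for y
    by (simp add: exp_integral_def fe)
  have hind: "integrable lborel (\<lambda>u. indicator {0..y} u * h u)" for y
    using exp_integral_integrable[OF cf, of y] by (simp add: fe)
  have G: "gamma_functional \<beta> f = (LINT u|lborel. h u * u powr (- \<beta>)) / Gamma (1 - \<beta>)" for \<beta>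
    unfolding gamma_functional_def fe using ac
    by (intro arg_cong2[where f = "(/)"] Bochner_Integration.integral_cong)
      (auto simp: indicator_def h_out)
  have Gint: "integrable lborel (\<lambda>u. h u * u powr (- \<beta>))" if "\<beta> < 1" for \<beta>
  proof -
    have "(\<lambda>u. h u * u powr (- \<beta>)) = (\<lambda>u. indicator {0..} u * (f (exp (- u)) * exp (- u) * u powr (- \<beta>)))"
    proof
      fix u
      show "h u * u powr (- \<beta>) = indicator {0..} u * (f (exp (- u)) * exp (- u) * u powr (- \<beta>))"
        unfolding fe using ac by (cases "u \<in> {a<..<c}") (simp_all add: h_out)
    qed
    thus ?thesis using gamma_functional_integrable[OF cf that] by simp
  qed
  show ?thesis
  proof (rule that[OF cf I])
    show "0 \<le> exp_integral f y" for y
      unfolding E by (intro integral_nonneg_AE AE_I2) (simp add: h_nn)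
    show "exp_integral f y \<le> I" for y
      unfolding E I_def by (intro integral_mono hind hint) (auto simp: indicator_def h_nn)
    show "exp_integral f y = 0" if "y \<le> a" for y
    proof -
      have "(\<lambda>u. indicator {0..y} u * h u) = (\<lambda>_. 0)"
        using that by (auto simp: indicator_def h_out)
      thus ?thesis unfolding E by simp
    qed
    show "exp_integral f y = I" if "c \<le> y" for y
    proof -
      have "(\<lambda>u. indicator {0..y} u * h u) = h"
      proof
        show "indicator {0..y} u * h u = h u" for u
          using that ac by (cases "u \<in> {a<..<c}") (simp_all add: h_out)
      qed
      thus ?thesis unfolding E I_def by simp
    qed
    fix \<beta> :: real assume \<beta>: "0 < \<beta>" "\<beta> < 1"
    have Gp: "Gamma (1 - \<beta>) > 0" using \<beta> by (simp add: Gamma_real_pos)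
    have "h u * c powr (- \<beta>) \<le> h u * u powr (- \<beta>)" for u
      using ac \<beta> by (cases "u \<in> {a<..<c}")
        (auto simp: h_out h_nn intro!: mult_left_mono powr_mono2')
    hence "(LINT u|lborel. h u * c powr (- \<beta>)) \<le> (LINT u|lborel. h u * u powr (- \<beta>))"
      using hint Gint[OF \<beta>(2)] by (intro integral_mono) auto
    thus "I * (c powr (- \<beta>) / Gamma (1 - \<beta>)) \<le> gamma_functional \<beta> f"
      unfolding G I_def using Gp by (simp add: divide_right_mono)
    have "h u * u powr (- \<beta>) \<le> h u * a powr (- \<beta>)" for u
      using ac \<beta> by (cases "u \<in> {a<..<c}")
        (auto simp: h_out h_nn intro!: mult_left_mono powr_mono2')
    hence "(LINT u|lborel. h u * u powr (- \<beta>)) \<le> (LINT u|lborel. h u * a powr (- \<beta>))"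
      using hint Gint[OF \<beta>(2)] by (intro integral_mono) auto
    thus "gamma_functional \<beta> f \<le> I * (a powr (- \<beta>) / Gamma (1 - \<beta>))"
      unfolding G I_def using Gp by (simp add: divide_right_mono)
  qed
qed

text \<open>On the monomial of degree \<open>m\<close> both functionals carry the factor
  \<open>1 / Suc m\<close>, so convergence there is exactly \<open>lim\<close> at
  \<open>Suc m\<close>. Some \<open>w j\<close> may be 0: the quotient is then 0, and linearity and
  the norm bound persist.\<close>

lemma (in prob_space) expectation_exp_integral_tendsto:
  fixes Y :: "nat \<Rightarrow> 'a \<Rightarrow> real" and w :: "nat \<Rightarrow> real"
  assumes Y[measurable]: "\<And>j. Y j \<in> borel_measurable M"
    and Y_nonneg: "\<And>j \<omega>. \<omega> \<in> space M \<Longrightarrow> 0 \<le> Y j \<omega>"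
    and w: "\<And>j. 0 \<le> w j" and \<beta>: "\<beta> < 1"
    and lim: "\<And>m. m \<ge> 1 \<Longrightarrow>
      (\<lambda>j. (1 - expectation (\<lambda>\<omega>. exp (- (real m * Y j \<omega>)))) / w j) \<longlonglongrightarrow> real m powr \<beta>"
    and f: "continuous_on UNIV f"
  shows "(\<lambda>j. expectation (\<lambda>\<omega>. exp_integral f (Y j \<omega>)) / w j) \<longlonglongrightarrow> gamma_functional \<beta> f"
proof -
  have meas: "(\<lambda>\<omega>. exp_integral g (Y j \<omega>)) \<in> borel_measurable M" if "continuous_on UNIV g" for g j
    using measurable_compose[OF Y exp_integral_measurable[OF that]] .
  \<comment> \<open>The value is \<open>1 - exp (- Y)\<close>; this makes all the functions
    \<open>exp_integral g\<close> bounded along \<open>Y\<close>.\<close>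
  have one: "exp_integral (\<lambda>_. 1) (Y j \<omega>) \<le> 1" "0 \<le> exp_integral (\<lambda>_. 1) (Y j \<omega>)"
    if "\<omega> \<in> space M" for j \<omega>
    using exp_integral_power[OF Y_nonneg[OF that], of 0 j] Y_nonneg[OF that, of j] by auto
  have int: "integrable M (\<lambda>\<omega>. exp_integral g (Y j \<omega>))" if g: "continuous_on UNIV g" for g j
  proof -
    have "bounded (g ` {0..1})"
      by (intro compact_imp_bounded compact_continuous_image continuous_on_subset[OF g]) auto
    then obtain B where B: "\<And>z. z \<in> {0..1} \<Longrightarrow> \<bar>g z\<bar> \<le> B"
      unfolding bounded_iff by (metis imageI real_norm_def)
    from B[of 0] have "B \<ge> 0" by auto
    have "norm (exp_integral g (Y j \<omega>)) \<le> B" if "\<omega> \<in> space M" for \<omega>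
    proof -
      have "\<bar>exp_integral g (Y j \<omega>)\<bar> \<le> B * exp_integral (\<lambda>_. 1) (Y j \<omega>)"
        using exp_integral_abs_le[OF g B] .
      also have "\<dots> \<le> B" using one[OF that] \<open>B \<ge> 0\<close> by (simp add: mult_left_le)
      finally show ?thesis by simp
    qed
    thus ?thesis by (intro integrable_const_bound[where B = B] AE_I2 meas g)
  qed
  show ?thesis
  proof (rule weierstrass_tendsto[where L = "\<lambda>j g. expectation (\<lambda>\<omega>. exp_integral g (Y j \<omega>)) / w j", OF _ _ _ _ _ f])
    show "expectation (\<lambda>\<omega>. exp_integral (\<lambda>z. c * g z + k z) (Y j \<omega>)) / w j =
        c * (expectation (\<lambda>\<omega>. exp_integral g (Y j \<omega>)) / w j) + expectation (\<lambda>\<omega>. exp_integral k (Y j \<omega>)) / w j"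
      if "continuous_on UNIV g" "continuous_on UNIV k" for j c g k
      using int[OF that(1)] int[OF that(2)] by (simp add: exp_integral_linear[OF that] add_divide_distrib)
    show "gamma_functional \<beta> (\<lambda>z. c * g z + k z) = c * gamma_functional \<beta> g + gamma_functional \<beta> k"
      if "continuous_on UNIV g" "continuous_on UNIV k" for c g k
      using gamma_functional_linear[OF that \<beta>] .
    show "\<bar>gamma_functional \<beta> g\<bar> \<le> e * gamma_functional \<beta> (\<lambda>_. 1)"
      if "continuous_on UNIV g" "\<And>z. z \<in> {0..1} \<Longrightarrow> \<bar>g z\<bar> \<le> e" for g e
      using gamma_functional_abs_le[OF that(1) \<beta> that(2)] .
    show "\<bar>expectation (\<lambda>\<omega>. exp_integral g (Y j \<omega>)) / w j\<bar> \<le> e * (expectation (\<lambda>\<omega>. exp_integral (\<lambda>_. 1) (Y j \<omega>)) / w j)"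
      if g: "continuous_on UNIV g" "\<And>z. z \<in> {0..1} \<Longrightarrow> \<bar>g z\<bar> \<le> e" for g e j
    proof -
      have "\<bar>expectation (\<lambda>\<omega>. exp_integral g (Y j \<omega>))\<bar> \<le> expectation (\<lambda>\<omega>. \<bar>exp_integral g (Y j \<omega>)\<bar>)"
        by (rule integral_abs_bound)
      also have "\<dots> \<le> expectation (\<lambda>\<omega>. e * exp_integral (\<lambda>_. 1) (Y j \<omega>))"
        using exp_integral_abs_le[OF g] int[OF g(1)] int[of "\<lambda>_. 1"]
        by (intro integral_mono) auto
      also have "\<dots> = e * expectation (\<lambda>\<omega>. exp_integral (\<lambda>_. 1) (Y j \<omega>))" by simp
      finally show ?thesis using w[of j] by (simp add: divide_right_mono)
    qed
    show "(\<lambda>j. expectation (\<lambda>\<omega>. exp_integral (\<lambda>z. z ^ m) (Y j \<omega>)) / w j)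
        \<longlonglongrightarrow> gamma_functional \<beta> (\<lambda>z. z ^ m)" for m
    proof -
      have "expectation (\<lambda>\<omega>. exp_integral (\<lambda>z. z ^ m) (Y j \<omega>)) =
          (1 - expectation (\<lambda>\<omega>. exp (- (real (Suc m) * Y j \<omega>)))) / real (Suc m)" for j
      proof -
        have "integrable M (\<lambda>\<omega>. exp (- (real (Suc m) * Y j \<omega>)))"
          using Y_nonneg by (intro integrable_const_bound[where B = 1]) auto
        hence "expectation (\<lambda>\<omega>. (1 - exp (- (real (Suc m) * Y j \<omega>))) / real (Suc m)) =
            (1 - expectation (\<lambda>\<omega>. exp (- (real (Suc m) * Y j \<omega>)))) / real (Suc m)"
          by (simp add: prob_space del: of_nat_Suc)
        moreover have "expectation (\<lambda>\<omega>. exp_integral (\<lambda>z. z ^ m) (Y j \<omega>)) =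
            expectation (\<lambda>\<omega>. (1 - exp (- (real (Suc m) * Y j \<omega>))) / real (Suc m))"
          by (intro Bochner_Integration.integral_cong refl exp_integral_power Y_nonneg)
        ultimately show ?thesis by simp
      qed
      hence "(\<lambda>j. expectation (\<lambda>\<omega>. exp_integral (\<lambda>z. z ^ m) (Y j \<omega>)) / w j) =
         (\<lambda>j. (1 - expectation (\<lambda>\<omega>. exp (- (real (Suc m) * Y j \<omega>)))) / w j / real (Suc m))"
        by (simp add: divide_divide_eq_left mult.commute)
      thus ?thesis
        unfolding gamma_functional_power[OF \<beta>]
        using tendsto_divide[OF lim[of "Suc m"] tendsto_const[of "real (Suc m)"]] by simp
    qed
  qed
qed

lemma (in prob_space) tail_tendsto:
  fixes Y :: "nat \<Rightarrow> 'a \<Rightarrow> real" and w :: "nat \<Rightarrow> real"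
  assumes Y[measurable]: "\<And>j. Y j \<in> borel_measurable M"
    and Y_nonneg: "\<And>j \<omega>. \<omega> \<in> space M \<Longrightarrow> 0 \<le> Y j \<omega>"
    and w: "\<And>j. 0 \<le> w j" and \<beta>: "0 < \<beta>" "\<beta> < 1"
    and lim: "\<And>m. m \<ge> 1 \<Longrightarrow>
      (\<lambda>j. (1 - expectation (\<lambda>\<omega>. exp (- (real m * Y j \<omega>)))) / w j) \<longlonglongrightarrow> real m powr \<beta>"
  shows "(\<lambda>j. prob {\<omega> \<in> space M. Y j \<omega> > 1} / w j) \<longlonglongrightarrow> 1 / Gamma (1 - \<beta>)"
proof -
  note lims = expectation_exp_integral_tendsto[OF Y Y_nonneg w \<beta>(2) lim]
  define q where "q j = prob {\<omega> \<in> space M. Y j \<omega> > 1}" for j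
  have q: "expectation (\<lambda>\<omega>. I * indicator {\<omega> \<in> space M. Y j \<omega> > 1} \<omega>) = I * q j" for I j
    by (simp add: q_def Int_def conj_commute)
  have qint: "integrable M (\<lambda>\<omega>. I * indicator {\<omega> \<in> space M. Y j \<omega> > 1} \<omega> :: real)" for I j
    by (intro integrable_mult_right integrable_real_indicator) (measurable, simp add: emeasure_eq_measure)
  have eint: "integrable M (\<lambda>\<omega>. exp_integral f (Y j \<omega>))"
    if "continuous_on UNIV f" "\<And>y. 0 \<le> exp_integral f y" "\<And>y. exp_integral f y \<le> I" for f I j
    using that measurable_compose[OF Y exp_integral_measurable[OF that(1)]]
    by (intro integrable_const_bound[where B = I]) auto
  have "((\<lambda>x. x powr (- \<beta>) / Gamma (1 - \<beta>)) \<longlongrightarrow> 1 powr (- \<beta>) / Gamma (1 - \<beta>)) (at 1)"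
    using less_imp_neq[OF Gamma_real_pos[of "1 - \<beta>"]] \<beta> by (intro tendsto_intros) auto
  hence cont: "((\<lambda>x. x powr (- \<beta>) / Gamma (1 - \<beta>)) \<longlongrightarrow> 1 / Gamma (1 - \<beta>)) (at 1)" by simp
  show ?thesis unfolding q_def[symmetric]
  proof (rule order_tendstoI)
    fix r assume r: "r < 1 / Gamma (1 - \<beta>)"
    \<comment> \<open>Continuity at 1 provides a \<open>c > 1\<close> so close to 1 that the lower
      bound from the bump on \<open>{1..c}\<close> still exceeds \<open>r\<close>.\<close>
    have "((\<lambda>x. x powr (- \<beta>) / Gamma (1 - \<beta>)) \<longlongrightarrow> 1 / Gamma (1 - \<beta>)) (at_right 1)"
      using cont by (rule filterlim_mono) (auto simp: at_within_le_at)
    from eventually_conj[OF order_tendstoD(1)[OF this r] eventually_at_right_less]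
    obtain c where c: "r < c powr (- \<beta>) / Gamma (1 - \<beta>)" "1 < c"
      using eventually_happens[of _ "at_right (1::real)"] by (auto simp: trivial_limit_at_right_real)
    obtain f I where f: "continuous_on UNIV f" "I > 0"
      "\<And>y. 0 \<le> exp_integral f y" "\<And>y. exp_integral f y \<le> I"
      "\<And>y. y \<le> 1 \<Longrightarrow> exp_integral f y = 0"
      "I * (c powr (- \<beta>) / Gamma (1 - \<beta>)) \<le> gamma_functional \<beta> f"
      using bump_exists[of 1 c] c(2) \<beta> by (metis zero_less_one)
    have "I * r < gamma_functional \<beta> f"
      using f(2,6) c(1) by (meson less_le_trans mult_strict_left_mono)
    hence "\<forall>\<^sub>F j in sequentially. I * r < expectation (\<lambda>\<omega>. exp_integral f (Y j \<omega>)) / w j"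
      by (rule order_tendstoD(1)[OF lims[OF _ _ f(1)], rotated 2]) auto
    thus "\<forall>\<^sub>F j in sequentially. r < q j / w j"
    proof eventually_elim
      case (elim j)
      \<comment> \<open>The ramp vanishes up to 1 and never exceeds \<open>I\<close>, so it lies
        below \<open>I\<close> times the indicator of \<open>Y > 1\<close>.\<close>
      have "expectation (\<lambda>\<omega>. exp_integral f (Y j \<omega>)) \<le> I * q j"
        unfolding q[symmetric] using f(4,5)
        by (intro integral_mono eint[OF f(1,3,4)] qint) (auto simp: indicator_def not_less)
      hence "expectation (\<lambda>\<omega>. exp_integral f (Y j \<omega>)) / w j \<le> I * (q j / w j)"
        using w[of j] by (simp add: divide_right_mono)
      with elim have "I * r < I * (q j / w j)" by simp
      thus ?case using mult_less_cancel_left_pos[OF f(2)] by blast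
    qed
  next
    fix r assume r: "1 / Gamma (1 - \<beta>) < r"
    have "((\<lambda>x. x powr (- \<beta>) / Gamma (1 - \<beta>)) \<longlongrightarrow> 1 / Gamma (1 - \<beta>)) (at_left 1)"
      using cont by (rule filterlim_mono) (auto simp: at_within_le_at)
    from eventually_conj[OF order_tendstoD(2)[OF this r] eventually_at_left_real[OF zero_less_one]]
    obtain a where a: "a powr (- \<beta>) / Gamma (1 - \<beta>) < r" "0 < a" "a < 1"
      using eventually_happens[of _ "at_left (1::real)"] by (auto simp: trivial_limit_at_left_real)
    obtain f I where f: "continuous_on UNIV f" "I > 0"
      "\<And>y. 0 \<le> exp_integral f y" "\<And>y. exp_integral f y \<le> I"
      "\<And>y. 1 \<le> y \<Longrightarrow> exp_integral f y = I"
      "gamma_functional \<beta> f \<le> I * (a powr (- \<beta>) / Gamma (1 - \<beta>))"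
      using bump_exists[of a 1] a(2,3) \<beta> by metis
    have "gamma_functional \<beta> f < I * r"
      using f(2,6) a(1) by (meson le_less_trans mult_strict_left_mono)
    hence "\<forall>\<^sub>F j in sequentially. expectation (\<lambda>\<omega>. exp_integral f (Y j \<omega>)) / w j < I * r"
      by (rule order_tendstoD(2)[OF lims[OF _ _ f(1)], rotated 2]) auto
    thus "\<forall>\<^sub>F j in sequentially. q j / w j < r"
    proof eventually_elim
      case (elim j)
      \<comment> \<open>This ramp has already reached \<open>I\<close> at 1 and is nonnegative
        before, so it lies above \<open>I\<close> times the indicator.\<close>
      have "I * q j \<le> expectation (\<lambda>\<omega>. exp_integral f (Y j \<omega>))"
        unfolding q[symmetric] using f(3,5)
        by (intro integral_mono eint[OF f(1,3,4)] qint) (auto simp: indicator_def)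
      hence "I * (q j / w j) \<le> expectation (\<lambda>\<omega>. exp_integral f (Y j \<omega>)) / w j"
        using w[of j] by (simp add: divide_right_mono)
      with elim have "I * (q j / w j) < I * r" by simp
      thus ?case using mult_less_cancel_left_pos[OF f(2)] by blast
    qed
  qed
qed

section \<open>Regular variation\<close>

text \<open>The powers leave \<open>c powr \<beta>\<close>, and the slowly varying parts cancel in
  the limit: slow variation is applied with factor \<open>1 / c\<close> at the argument
  \<open>1 / x\<close>, which tends to infinity.\<close>

lemma regularly_varying_at_zero_ratio:
  assumes "regularly_varying_at_zero \<beta> \<psi>" "c > 0"
  shows "((\<lambda>x. \<psi> (c * x) / \<psi> x) \<longlongrightarrow> c powr \<beta>) (at_right 0)"
proof -
  obtain l where l: "slowly_varying l" "\<forall>\<^sub>F x in at_right 0. \<psi> x = x powr \<beta> * l (1 / x)"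
    using assms by (auto simp: regularly_varying_at_zero_def)
  have inv: "filterlim (\<lambda>x::real. 1 / x) at_top (at_right 0)"
    using filterlim_inverse_at_top_right by (simp add: inverse_eq_divide)
  have "((\<lambda>x. l (1 / c * x) / l x) \<longlongrightarrow> 1) at_top"
    using l(1)[unfolded slowly_varying_def, rule_format, of "1 / c"] assms(2) by simp
  from filterlim_compose[OF this inv]
  have "((\<lambda>x. c powr \<beta> * (l (1 / c * (1 / x)) / l (1 / x))) \<longlongrightarrow> c powr \<beta> * 1) (at_right 0)"
    by (intro tendsto_intros)
  hence *: "((\<lambda>x. c powr \<beta> * (l (1 / (c * x)) / l (1 / x))) \<longlongrightarrow> c powr \<beta>) (at_right 0)"
    by (simp add: mult.commute)
  have "filterlim (\<lambda>x. c * x) (at_right 0) (at_right (0::real))"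
    using assms(2) by (auto intro!: tendsto_eq_intros simp: filterlim_at eventually_at_filter)
  from eventually_compose_filterlim[OF l(2) this] l(2) eventually_at_right_less[of "0::real"]
  have "\<forall>\<^sub>F x in at_right 0. c powr \<beta> * (l (1 / (c * x)) / l (1 / x)) = \<psi> (c * x) / \<psi> x"
    by eventually_elim (use assms(2) in \<open>simp add: powr_mult\<close>)
  with * show ?thesis by (rule Lim_transform_eventually)
qed

text \<open>Put \<open>c = (1 - exp (- (m * x))) / (m * x)\<close>, which tends to 1 from below.
  Scaling and monotonicity place \<open>\<psi> (1 - exp (- (m * x)))\<close> between
  \<open>c * \<psi> (m * x)\<close> and \<open>\<psi> (m * x)\<close>, so regular variation decides
  the limit.\<close>

lemma levy_triplet_exp_ratio:
  assumes L: "levy_triplet \<psi> a b \<nu>" and pos: "\<And>x. 0 \<le> x \<Longrightarrow> 0 \<le> \<psi> x"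
    and rv: "regularly_varying_at_zero \<beta> \<psi>" and m: "m > 0"
  shows "((\<lambda>x. \<psi> (1 - exp (- (m * x))) / \<psi> x) \<longlongrightarrow> m powr \<beta>) (at_right 0)"
proof -
  note R = regularly_varying_at_zero_ratio[OF rv m]
  have "filterlim (\<lambda>x. - (m * x)) (at 0) (at_right 0)"
    using m by (auto intro!: tendsto_eq_intros simp: filterlim_at eventually_at_filter)
  from filterlim_compose[OF lim_exp_minus_1 this]
  have "((\<lambda>x. (1 - exp (- (m * x))) / (m * x)) \<longlongrightarrow> 1) (at_right 0)"
    by (simp add: minus_divide_left)
  from tendsto_mult[OF this R]
  have low: "((\<lambda>x. (1 - exp (- (m * x))) / (m * x) * (\<psi> (m * x) / \<psi> x)) \<longlongrightarrow> m powr \<beta>) (at_right 0)"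
    by simp
  show ?thesis
  proof (rule tendsto_sandwich[OF _ _ low R])
    have bound: "(1 - exp (- (m * x))) / (m * x) * (\<psi> (m * x) / \<psi> x) \<le> \<psi> (1 - exp (- (m * x))) / \<psi> x \<and>
        \<psi> (1 - exp (- (m * x))) / \<psi> x \<le> \<psi> (m * x) / \<psi> x" if "x > 0" for x
    proof -
      have mx: "m * x > 0" using m that by simp
      define c where "c = (1 - exp (- (m * x))) / (m * x)"
      have e: "1 - exp (- (m * x)) \<le> m * x"
        using exp_ge_add_one_self[of "- (m * x)"] by simp
      have c: "0 \<le> c" "c \<le> 1" "c * (m * x) = 1 - exp (- (m * x))"
        using mx e by (auto simp: c_def divide_simps)
      have "c * \<psi> (m * x) \<le> \<psi> (1 - exp (- (m * x)))"
        using levy_triplet_scale[OF L _ c(1,2), of "m * x"] mx c(3) by simp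
      moreover have "\<psi> (1 - exp (- (m * x))) \<le> \<psi> (m * x)"
        using mx e by (intro levy_triplet_mono[OF L]) auto
      ultimately show ?thesis
        using divide_right_mono[OF _ pos[of x]] that by (fastforce simp: c_def)
    qed
    show "\<forall>\<^sub>F x in at_right 0. (1 - exp (- (m * x))) / (m * x) * (\<psi> (m * x) / \<psi> x) \<le> \<psi> (1 - exp (- (m * x))) / \<psi> x"
      using eventually_at_right_less[of "0::real"] by eventually_elim (use bound in blast)
    show "\<forall>\<^sub>F x in at_right 0. \<psi> (1 - exp (- (m * x))) / \<psi> x \<le> \<psi> (m * x) / \<psi> x"
      using eventually_at_right_less[of "0::real"] by eventually_elim (use bound in blast)
  qed
qed

text \<open>Both bounds are asymptotic to \<open>n * p\<close> when \<open>n * p\<close> tends to 0.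
  The first is Bernoulli's inequality for \<open>- p\<close>; the second uses it for
  \<open>p\<close>, together with \<open>(1 - p) * (1 + p) \<le> 1\<close>.\<close>

lemma one_minus_power_bounds:
  fixes p :: real
  assumes "0 \<le> p" "p \<le> 1"
  shows "1 - (1 - p) ^ n \<le> real n * p" "real n * p / (1 + real n * p) \<le> 1 - (1 - p) ^ n"
proof -
  show "1 - (1 - p) ^ n \<le> real n * p"
    using Bernoulli_inequality[of "- p" n] assms by simp
  have pos: "1 + real n * p > 0" using assms by (simp add: add_pos_nonneg)
  have "(1 - p) ^ n * (1 + real n * p) \<le> (1 - p) ^ n * (1 + p) ^ n"
    using Bernoulli_inequality[of p n] assms by (intro mult_left_mono) auto
  also have "\<dots> = (1 - p\<^sup>2) ^ n"
    by (simp add: power2_eq_square algebra_simps flip: power_mult_distrib)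
  also have "\<dots> \<le> 1" using assms by (intro power_le_one) (auto simp: power_le_one)
  finally show "real n * p / (1 + real n * p) \<le> 1 - (1 - p) ^ n"
    using pos by (simp add: divide_simps algebra_simps)
qed

section \<open>Tail asymptotics along arbitrary sequences \<open>n\<close> and \<open>t\<close> in
  the regime\<close>

theorem theorem2p2:
  fixes \<alpha> a b :: real and \<psi> :: "real \<Rightarrow> real" and \<nu> :: "real measure"
    and M :: "'w measure" and R :: "nat \<Rightarrow> 'w \<Rightarrow> nat"
    and n :: "nat \<Rightarrow> nat" and t :: "nat \<Rightarrow> real"
  assumes "0 < \<alpha>" and "\<alpha> < 2"
    and "bernstein_function \<psi>" and "levy_triplet \<psi> a b \<nu>"
    and "regularly_varying_at_zero (\<alpha> / 2) \<psi>"
    and "\<psi> 0 = 0" and "\<psi> 1 = 1"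
    and "subordinator_steps M b \<nu> R"
    and "filterlim n at_top sequentially"
    and "filterlim t at_top sequentially"
    and "(\<lambda>j. real (n j) * \<psi> (inverse (t j))) \<longlonglongrightarrow> 0"
  shows "(\<lambda>j. (1 - subordinator_cdf M R (n j) (t j)) /
              (real (n j) * \<psi> (inverse (t j)) / Gamma (1 - \<alpha> / 2))) \<longlonglongrightarrow> 1"
proof -
  interpret prob_space M using assms(8) by (simp add: subordinator_steps_def)
  define \<beta> where "\<beta> = \<alpha> / 2"
  have \<beta>: "0 < \<beta>" "\<beta> < 1" using assms(1,2) by (auto simp: \<beta>_def)
  have nonneg: "0 \<le> \<psi> x" if "x \<ge> 0" for x
    using assms(3) that by (simp add: bernstein_function_def)
  \<comment> \<open>Truncating \<open>t\<close> at \<open>1\<close> changes only finitely many terms.\<close>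
  define x where "x j = inverse (max 1 (t j))" for j
  have x_pos: "x j > 0" for j by (simp add: x_def less_max_iff_disj)
  have t_ev: "\<forall>\<^sub>F j in sequentially. t j \<ge> 1"
    using assms(10) by (auto simp: filterlim_at_top)
  have x_ev: "\<forall>\<^sub>F j in sequentially. x j = inverse (t j)"
    using t_ev by eventually_elim (simp add: x_def max_def)
  have "\<forall>\<^sub>F j in sequentially. inverse (t j) = x j"
    using x_ev by eventually_elim simp
  with tendsto_inverse_0_at_top[OF assms(10)] have "x \<longlonglongrightarrow> 0"
    by (rule Lim_transform_eventually)
  hence x_lim: "filterlim x (at_right 0) sequentially"
    using x_pos by (auto simp: filterlim_at less_imp_neq[symmetric] intro!: always_eventually)
  define w where "w j = real (n j) * \<psi> (x j)" for j
  have w_nonneg: "0 \<le> w j" for j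
    using nonneg[of "x j"] x_pos[of j] by (simp add: w_def)
  have w_ev: "\<forall>\<^sub>F j in sequentially. w j = real (n j) * \<psi> (inverse (t j))"
    using x_ev by eventually_elim (simp add: w_def)
  have "\<forall>\<^sub>F j in sequentially. real (n j) * \<psi> (inverse (t j)) = w j"
    using w_ev by eventually_elim simp
  with assms(11) have w_lim: "w \<longlonglongrightarrow> 0" by (rule Lim_transform_eventually)
  \<comment> \<open>Scaling by \<open>x j\<close> instead of dividing by \<open>t j\<close> keeps
    \<open>Y j\<close> nonnegative for every \<open>j\<close>, including those with
    \<open>t j \<le> 0\<close>.\<close>
  define Y where "Y j \<omega> = real (discrete_subordinator R (n j) \<omega>) * x j" for j \<omega>
  have tau[measurable]: "discrete_subordinator R k \<in> measurable M (count_space UNIV)" for k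
    by (rule discrete_subordinator_measurable[OF assms(8)])
  have Y[measurable]: "Y j \<in> borel_measurable M" for j
    unfolding Y_def[abs_def] by measurable
  have lap: "expectation (\<lambda>\<omega>. exp (- (real m * Y j \<omega>))) = (1 - \<psi> (1 - exp (- (real m * x j)))) ^ n j" for m j
  proof -
    have "exp (- (real m * Y j \<omega>)) = exp (- (real m * x j)) ^ discrete_subordinator R (n j) \<omega>" for \<omega>
      by (simp add: Y_def mult_ac flip: exp_of_nat_mult)
    thus ?thesis
      using discrete_subordinator_gf[OF assms(8,4,6,7), of "exp (- (real m * x j))" "n j"] x_pos[of j]
      by simp
  qed
  have lim: "(\<lambda>j. (1 - expectation (\<lambda>\<omega>. exp (- (real m * Y j \<omega>)))) / w j) \<longlonglongrightarrow> real m powr \<beta>"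
    if m: "m \<ge> 1" for m
  proof -
    define p where "p j = \<psi> (1 - exp (- (real m * x j)))" for j
    \<comment> \<open>The upper bound is monotonicity together with
      \<open>\<psi> 1 = 1\<close>.\<close>
    have p: "0 \<le> p j" "p j \<le> 1" for j
      using nonneg levy_triplet_mono[OF assms(4), of "1 - exp (- (real m * x j))" 1] x_pos[of j] assms(7)
      by (auto simp: p_def)
    have "(\<lambda>j. p j / \<psi> (x j)) \<longlonglongrightarrow> real m powr \<beta>"
      using filterlim_compose[OF levy_triplet_exp_ratio[OF assms(4) nonneg assms(5)] x_lim, of "real m"] m
      by (simp add: p_def \<beta>_def)
    moreover have "\<forall>\<^sub>F j in sequentially. p j / \<psi> (x j) = real (n j) * p j / w j"
      using filterlim_at_top[THEN iffD1, OF assms(9), rule_format, of 1]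
      by eventually_elim (simp add: w_def)
    ultimately have np: "(\<lambda>j. real (n j) * p j / w j) \<longlonglongrightarrow> real m powr \<beta>"
      by (rule Lim_transform_eventually)
    have np_eq: "real (n j) * p j / w j * w j = real (n j) * p j" if "w j \<noteq> 0" for j
      using that by simp
    \<comment> \<open>Where \<open>w j = 0\<close>, the quotient in \<open>np\<close> takes the
      default value 0, which its positive limit excludes for large \<open>j\<close>. Hence
      multiplying back by \<open>w j\<close> is legitimate and gives \<open>np0\<close>.\<close>
    have w_ne: "\<forall>\<^sub>F j in sequentially. w j \<noteq> 0"
    proof -
      have "real m powr \<beta> > 0" using m by simp
      from order_tendstoD(1)[OF np this] show ?thesis by eventually_elim auto
    qed
    have "(\<lambda>j. real (n j) * p j / w j * w j) \<longlonglongrightarrow> real m powr \<beta> * 0"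
      by (intro tendsto_mult np w_lim)
    hence np0: "(\<lambda>j. real (n j) * p j) \<longlonglongrightarrow> 0"
      using Lim_transform_eventually[OF _ eventually_mono[OF w_ne np_eq]] by simp
    have "(\<lambda>j. real (n j) * p j / w j / (1 + real (n j) * p j)) \<longlonglongrightarrow> real m powr \<beta> / (1 + 0)"
      by (intro tendsto_intros np np0) auto
    hence low: "(\<lambda>j. real (n j) * p j / w j / (1 + real (n j) * p j)) \<longlonglongrightarrow> real m powr \<beta>" by simp
    have "(\<lambda>j. (1 - (1 - p j) ^ n j) / w j) \<longlonglongrightarrow> real m powr \<beta>"
    \<comment> \<open>The denominator \<open>1 + n * p\<close> of the lower bound tends to 1 by
      \<open>np0\<close>, so the two outer limits agree.\<close>
    proof (rule tendsto_sandwich[OF _ _ low np]; rule always_eventually; rule allI)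
      fix j
      show "(1 - (1 - p j) ^ n j) / w j \<le> real (n j) * p j / w j"
        using one_minus_power_bounds(1)[OF p[of j]] w_nonneg by (rule divide_right_mono)
      have "real (n j) * p j / (1 + real (n j) * p j) / w j \<le> (1 - (1 - p j) ^ n j) / w j"
        using one_minus_power_bounds(2)[OF p[of j]] w_nonneg by (rule divide_right_mono)
      thus "real (n j) * p j / w j / (1 + real (n j) * p j) \<le> (1 - (1 - p j) ^ n j) / w j"
        by (simp add: mult.commute)
    qed
    thus ?thesis by (simp add: lap p_def)
  qed
  have "(\<lambda>j. prob {\<omega> \<in> space M. Y j \<omega> > 1} / w j) \<longlonglongrightarrow> 1 / Gamma (1 - \<beta>)"
    using x_pos by (intro tail_tendsto Y w_nonneg \<beta> lim) (auto simp: Y_def less_imp_le)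
  hence "(\<lambda>j. prob {\<omega> \<in> space M. Y j \<omega> > 1} / w j * Gamma (1 - \<beta>)) \<longlonglongrightarrow> 1 / Gamma (1 - \<beta>) * Gamma (1 - \<beta>)"
    by (rule tendsto_mult_right)
  moreover have "1 / Gamma (1 - \<beta>) * Gamma (1 - \<beta>) = 1"
    using less_imp_neq[OF Gamma_real_pos[of "1 - \<beta>"]] \<beta> by simp
  ultimately have res: "(\<lambda>j. prob {\<omega> \<in> space M. Y j \<omega> > 1} / w j * Gamma (1 - \<beta>)) \<longlonglongrightarrow> 1"
    by simp
  have "\<forall>\<^sub>F j in sequentially. prob {\<omega> \<in> space M. Y j \<omega> > 1} / w j * Gamma (1 - \<beta>) =
      (1 - subordinator_cdf M R (n j) (t j)) / (real (n j) * \<psi> (inverse (t j)) / Gamma (1 - \<alpha> / 2))"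
    using t_ev x_ev w_ev
  proof eventually_elim
    case (elim j)
    \<comment> \<open>For \<open>t j \<ge> 1\<close> one has \<open>x j = 1 / t j\<close>, so
      \<open>Y j > 1\<close> means that the subordinator strictly exceeds \<open>t j\<close>, the
      complement of the event in the distribution function.\<close>
    have "{\<omega> \<in> space M. Y j \<omega> > 1} = space M - {\<omega> \<in> space M. real (discrete_subordinator R (n j) \<omega>) \<le> t j}"
      using elim(1) by (auto simp: Y_def elim(2) inverse_eq_divide less_divide_eq not_le)
    hence "prob {\<omega> \<in> space M. Y j \<omega> > 1} = 1 - subordinator_cdf M R (n j) (t j)"
      unfolding subordinator_cdf_def by (simp add: prob_compl)
    thus ?case using elim by (simp add: \<beta>_def)
  qed
  with res show ?thesis by (rule Lim_transform_eventually)
qed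

end
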